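(* Let $s\ge2$ and let $G$ be a fixed $s$-uniform hypergraph of degeneracy $d\ge2$. Let $\omega=\omega(n)\to\infty$ as $n\to\infty$ and $t=n^{(d-1)/d}/\omega$. Then for any strategy $\mathcal S$ in the semi-random hypergraph process with $r=1$, $$\lim_{n\to\infty}\mathbb P\big[H_t^{(1,s)}\text{ contains a sub-hypergraph isomorphic to } G\big]=0.$$
   Context: Semi-random hypergraph process with parameters $1\le r\le s$ on $[n]$: start with the empty hypergraph $H_0^{(r,s)}$ on $[n]$. In each step $t\ge1$ a set $U_t$ of $r$ vertices is chosen uniformly at random from $\binom{[n]}{r}$; the player, knowing the history and $U_t$, selects $s-r$ vertices $V_t$ (repetitions and overlap with $U_t$ allowed; the choice may be randomized according to a distribution depending on the history and $U_t$, and such a rule is a strategy $\mathcal S$), and the edge $U_t\cup V_t$ (as a multiset of size $s$) is added to form $H_t^{(r,s)}$; parallel edges are allowed. A hypergraph $G$ is $d$-degenerate if every sub-hypergraph $G'\subseteq G$ has minimum degree at most $d$; the degeneracy of $G$ is the smallest such $d$. *)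

theory Defs
  imports "HOL-Probability.Probability" "HOL-Library.Multiset"
begin

section \<open>Hypergraphs\<close>

text \<open>Edges are multisets of vertices and the edges form a multiset, because the random
  process may produce parallel edges and edges with repeated vertices. Ordinary hypergraphs,
  with a set of edges that are sets of vertices, are included as a special case.\<close>

record 'a hypergraph =
  verts :: "'a set"
  edges :: "'a multiset multiset"

definition hypergraph :: "'a hypergraph \<Rightarrow> bool" where
  "hypergraph H \<longleftrightarrow> finite (verts H) \<and> (\<forall>e \<in># edges H. set_mset e \<subseteq> verts H)"

definition uniform :: "nat \<Rightarrow> 'a hypergraph \<Rightarrow> bool" where
  "uniform s H \<longleftrightarrow> (\<forall>e \<in># edges H. size e = s)"

definition subhypergraph :: "'a hypergraph \<Rightarrow> 'a hypergraph \<Rightarrow> bool" where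
  "subhypergraph H' H \<longleftrightarrow> hypergraph H' \<and> verts H' \<subseteq> verts H \<and> edges H' \<subseteq># edges H"

definition isomorphic :: "'a hypergraph \<Rightarrow> 'b hypergraph \<Rightarrow> bool" where
  "isomorphic G H \<longleftrightarrow>
    (\<exists>f. bij_betw f (verts G) (verts H) \<and> edges H = image_mset (image_mset f) (edges G))"

definition contains_copy :: "'b hypergraph \<Rightarrow> 'a hypergraph \<Rightarrow> bool" where
  "contains_copy H G \<longleftrightarrow> (\<exists>H'. subhypergraph H' H \<and> isomorphic G H')"

text \<open>Parallel edges are counted separately, but an edge containing \<open>v\<close> several times
  contributes only once to the degree of \<open>v\<close>.\<close>

definition vertex_degree :: "'a hypergraph \<Rightarrow> 'a \<Rightarrow> nat" where
  "vertex_degree H v = size (filter_mset (\<lambda>e. v \<in># e) (edges H))"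

definition min_degree :: "'a hypergraph \<Rightarrow> nat" where
  "min_degree H = Min (vertex_degree H ` verts H)"

text \<open>The sub-hypergraph without vertices has no minimum degree and is excluded.\<close>

definition degenerate :: "nat \<Rightarrow> 'a hypergraph \<Rightarrow> bool" where
  "degenerate d G \<longleftrightarrow> (\<forall>G'. subhypergraph G' G \<and> verts G' \<noteq> {} \<longrightarrow> min_degree G' \<le> d)"

definition degeneracy :: "'a hypergraph \<Rightarrow> nat" where
  "degeneracy G = (LEAST d. degenerate d G)"

section \<open>The semi-random hypergraph process\<close>

text \<open>A history lists, in chronological order, the random set \<open>U\<close> and the multiset \<open>V\<close>
  selected by the player in each step. A strategy maps the history and the current random set
  to a distribution on the selections of the player.\<close>

type_synonym history = "(nat set \<times> nat multiset) list"
type_synonym strategy = "history \<Rightarrow> nat set \<Rightarrow> nat multiset pmf"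

definition random_choices :: "nat \<Rightarrow> nat \<Rightarrow> nat set set" where
  "random_choices n r = {U. U \<subseteq> {1..n} \<and> card U = r}"

definition player_choices :: "nat \<Rightarrow> nat \<Rightarrow> nat multiset set" where
  "player_choices n k = {V. set_mset V \<subseteq> {1..n} \<and> size V = k}"

definition valid_strategy :: "nat \<Rightarrow> nat \<Rightarrow> nat \<Rightarrow> strategy \<Rightarrow> bool" where
  "valid_strategy n r s S \<longleftrightarrow>
    (\<forall>h \<in> lists (random_choices n r \<times> player_choices n (s - r)).
      \<forall>U \<in> random_choices n r. set_pmf (S h U) \<subseteq> player_choices n (s - r))"

text \<open>For \<open>r > n\<close> the set \<open>random_choices n r\<close> is empty and the process is meaningless.\<close>

primrec history_pmf :: "nat \<Rightarrow> nat \<Rightarrow> strategy \<Rightarrow> nat \<Rightarrow> history pmf" where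
  "history_pmf n r S 0 = return_pmf []"
| "history_pmf n r S (Suc t) =
    bind_pmf (history_pmf n r S t) (\<lambda>h.
      bind_pmf (pmf_of_set (random_choices n r)) (\<lambda>U.
        map_pmf (\<lambda>V. h @ [(U, V)]) (S h U)))"

definition history_hypergraph :: "nat \<Rightarrow> history \<Rightarrow> nat hypergraph" where
  "history_hypergraph n h =
    \<lparr>verts = {1..n}, edges = mset (map (\<lambda>(U, V). mset_set U + V) h)\<rparr>"

text \<open>The distribution of $H_t^{(r,s)}$; the parameter $s$ enters through the requirement
  \<open>valid_strategy n r s S\<close>.\<close>

definition semirandom_hypergraph :: "nat \<Rightarrow> nat \<Rightarrow> strategy \<Rightarrow> nat \<Rightarrow> nat hypergraph pmf" where
  "semirandom_hypergraph n r S t = map_pmf (history_hypergraph n) (history_pmf n r S t)"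

end

theory Submission
  imports Defs
begin

text \<open>For a set \<open>F\<close> of steps draw an arc from the random vertex of each step in \<open>F\<close> to every
  vertex of its edge, and call a vertex \<open>j\<close>-rich if, for some \<open>F\<close> of bounded size, all its
  ancestors (itself included) have degree at least \<open>j\<close> in \<open>F\<close>. A subgraph of minimum
  degree \<open>d\<close> makes all of its vertices \<open>d\<close>-rich. A vertex can become \<open>(j + 1)\<close>-rich only in a
  step whose random vertex is one of its ancestors, and this random vertex was \<open>j\<close>-rich before,
  because one step changes degrees by at most one. As long as no vertex is \<open>d\<close>-rich, every vertex
  has been random fewer than \<open>d\<close> times, so only boundedly many vertices are reached from it by
  short paths. Hence each step creates in expectation at most \<open>C / n\<close> times the current
  number of \<open>j\<close>-rich vertices as new \<open>(j + 1)\<close>-rich ones, and inductively the expected number of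
  \<open>j\<close>-rich vertices is at most \<open>n (C t / n)^j\<close>. For \<open>j = d\<close> this is at most \<open>(C / \<omega>)^d\<close>.\<close>

section \<open>Rich vertices\<close>

definition step_verts :: "nat set \<times> nat multiset \<Rightarrow> nat set" where
  "step_verts x = fst x \<union> set_mset (snd x)"

definition arcs :: "history \<Rightarrow> nat set \<Rightarrow> (nat \<times> nat) set" where
  "arcs h F = {(u, v). \<exists>i\<in>F. u \<in> fst (h ! i) \<and> v \<in> step_verts (h ! i)}"

text \<open>Steps are counted, in agreement with \<open>vertex_degree\<close>: parallel edges count
  separately, a repeated vertex of one edge only once.\<close>

definition step_degree :: "history \<Rightarrow> nat set \<Rightarrow> nat \<Rightarrow> nat" where
  "step_degree h F a = card {i \<in> F. a \<in> step_verts (h ! i)}"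

definition rich :: "history \<Rightarrow> nat \<Rightarrow> nat \<Rightarrow> nat \<Rightarrow> bool" where
  "rich h m j v \<longleftrightarrow> (\<exists>F. F \<subseteq> {..<length h} \<and> card F \<le> m \<and>
     (\<forall>a. (a, v) \<in> (arcs h F)\<^sup>* \<longrightarrow> j \<le> step_degree h F a))"

abbreviation histories :: "nat \<Rightarrow> nat \<Rightarrow> history set" where
  "histories n s \<equiv> lists (random_choices n 1 \<times> player_choices n (s - 1))"

section \<open>Effect of one more step on richness\<close>

lemma arcs_append:
  assumes "F \<subseteq> {..<length h}"
  shows "arcs (h @ [x]) F = arcs h F"
proof -
  have "(h @ [x]) ! i = h ! i" if "i \<in> F" for i
    using assms that by (auto simp: nth_append)
  then show ?thesis unfolding arcs_def by auto
qed

lemma step_degree_append: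
  assumes "F \<subseteq> {..<length h}"
  shows "step_degree (h @ [x]) F a = step_degree h F a"
proof -
  have "(h @ [x]) ! i = h ! i" if "i \<in> F" for i
    using assms that by (auto simp: nth_append)
  then have "{i \<in> F. a \<in> step_verts ((h @ [x]) ! i)} = {i \<in> F. a \<in> step_verts (h ! i)}"
    by auto
  then show ?thesis by (simp add: step_degree_def)
qed

lemma rich_append:
  assumes "rich h m j v"
  shows "rich (h @ [x]) m j v"
proof -
  from assms obtain F where F: "F \<subseteq> {..<length h}" "card F \<le> m"
    "\<forall>a. (a, v) \<in> (arcs h F)\<^sup>* \<longrightarrow> j \<le> step_degree h F a"
    by (auto simp: rich_def)
  show ?thesis unfolding rich_def
    using F arcs_append[OF F(1)] step_degree_append[OF F(1)]
    by (intro exI[of _ F]) auto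
qed

lemma arcs_mono: "F \<subseteq> F' \<Longrightarrow> arcs h F \<subseteq> arcs h F'"
  by (auto simp: arcs_def)

text \<open>The new step must belong to \<open>F\<close> and meet an ancestor of \<open>v\<close>,
  since otherwise \<open>F\<close> without it would serve for \<open>h\<close>. Hence
  \<open>w\<close> is an ancestor of \<open>v\<close> as well, and the ancestors of
  \<open>w\<close>, being ancestors of \<open>v\<close>, lose at most one degree when the new step
  is deleted.\<close>

lemma rich_append_new:
  assumes rich: "rich (h @ [x]) m (Suc j) v" and nrich: "\<not> rich h m (Suc j) v" and x: "fst x = {w}"
  obtains F where "rich h m j w" "F \<subseteq> {..<length (h @ [x])}" "card F \<le> m"
    "(w, v) \<in> (arcs (h @ [x]) F)\<^sup>*"
proof -
  let ?l = "length h" and ?h = "h @ [x]"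
  from rich obtain F where F: "F \<subseteq> {..<length ?h}" "card F \<le> m"
    and deg: "\<And>a. (a, v) \<in> (arcs ?h F)\<^sup>* \<Longrightarrow> Suc j \<le> step_degree ?h F a"
    by (auto simp: rich_def)
  have finF: "finite F" using F(1) finite_subset by blast
  define F' where "F' = F - {?l}"
  have F': "F' \<subseteq> {..<?l}" using F(1) by (auto simp: F'_def)
  have cF': "card F' \<le> m" using F(2) finF card_mono[of F F'] by (auto simp: F'_def)
  have anc: "(arcs h F')\<^sup>* \<subseteq> (arcs ?h F)\<^sup>*"
    using arcs_append[OF F'] arcs_mono[of F' F ?h] by (auto simp: F'_def intro!: rtrancl_mono)
  have "\<exists>a. (a, v) \<in> (arcs ?h F)\<^sup>* \<and> ?l \<in> F \<and> a \<in> step_verts x"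
  proof (rule ccontr)
    assume neg: "\<not> ?thesis"
    have "Suc j \<le> step_degree h F' a" if "(a, v) \<in> (arcs h F')\<^sup>*" for a
    proof -
      have a: "(a, v) \<in> (arcs ?h F)\<^sup>*" using that anc by auto
      have "{i \<in> F. a \<in> step_verts (?h ! i)} = {i \<in> F'. a \<in> step_verts (?h ! i)}"
        using neg a by (auto simp: F'_def)
      then have "step_degree ?h F a = step_degree ?h F' a" by (simp add: step_degree_def)
      then show ?thesis using deg[OF a] step_degree_append[OF F'] by simp
    qed
    then have "rich h m (Suc j) v" using F' cF' by (auto simp: rich_def)
    with nrich show False by simp
  qed
  then obtain a where a: "(a, v) \<in> (arcs ?h F)\<^sup>*" "?l \<in> F" "a \<in> step_verts x" by auto
  have "(w, a) \<in> arcs ?h F" using a x by (auto simp: arcs_def intro!: bexI[of _ ?l])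
  then have wv: "(w, v) \<in> (arcs ?h F)\<^sup>*" using a(1) by (rule converse_rtrancl_into_rtrancl)
  have "j \<le> step_degree h F' b" if "(b, w) \<in> (arcs h F')\<^sup>*" for b
  proof -
    have "(b, v) \<in> (arcs ?h F)\<^sup>*" using that anc wv by (meson rtrancl_trans subsetD)
    then have "Suc j \<le> step_degree ?h F b" by (rule deg)
    also have "\<dots> \<le> card (insert ?l {i \<in> F'. b \<in> step_verts (?h ! i)})"
      unfolding step_degree_def using finF by (intro card_mono) (auto simp: F'_def)
    also have "\<dots> \<le> Suc (step_degree ?h F' b)"
      unfolding step_degree_def using finF by (simp add: card_insert_if F'_def)
    finally show ?thesis using step_degree_append[OF F'] by simp
  qed
  then have "rich h m j w" using F' cF' by (auto simp: rich_def)
  with that F wv show thesis by blast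
qed

text \<open>Take \<open>d\<close> steps with random vertex \<open>w\<close> as \<open>F\<close>. All
  their arcs leave \<open>w\<close>, so \<open>w\<close> has no other ancestor.\<close>

lemma rich_if_hit:
  assumes "d \<le> card {i. i < length h \<and> w \<in> fst (h ! i)}" "d \<le> m"
    and single: "\<And>x. x \<in> set h \<Longrightarrow> card (fst x) = 1"
  shows "rich h m d w"
proof -
  obtain F where F: "F \<subseteq> {i. i < length h \<and> w \<in> fst (h ! i)}" "card F = d"
    using assms(1) by (meson obtain_subset_with_card_n)
  have sq: "fst (h ! i) = {w}" if "i \<in> F" for i
  proof -
    have "card (fst (h ! i)) = 1" using F that by (intro single) auto
    moreover have "w \<in> fst (h ! i)" using F that by auto
    ultimately show ?thesis by (auto simp: card_1_singleton_iff)
  qed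
  have "a = w" if "(a, w) \<in> (arcs h F)\<^sup>*" for a
    using that by (cases rule: converse_rtranclE) (auto simp: arcs_def sq)
  moreover have "step_degree h F w = d"
  proof -
    have "{i \<in> F. w \<in> step_verts (h ! i)} = F" using F by (auto simp: step_verts_def)
    then show ?thesis using F by (simp add: step_degree_def)
  qed
  ultimately show ?thesis unfolding rich_def
    using F assms(2) by (intro exI[of _ F]) auto
qed

section \<open>Counting vertices reached by short paths\<close>

lemma relpow_subset_mono:
  fixes R R' :: "('a \<times> 'a) set"
  assumes "R \<subseteq> R'"
  shows "R ^^ k \<subseteq> R' ^^ k"
  using assms by (induction k) (auto intro: relcomp_mono)

lemma card_relpow_Image_le:
  fixes R :: "('a \<times> 'a) set"
  assumes "\<And>u. finite (R `` {u}) \<and> card (R `` {u}) \<le> D"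
  shows "finite ((R ^^ k) `` {w}) \<and> card ((R ^^ k) `` {w}) \<le> D ^ k"
proof (induction k)
  case 0
  have "(R ^^ 0) `` {w} = {w}" by auto
  then show ?case by simp
next
  case (Suc k)
  let ?A = "(R ^^ k) `` {w}"
  have eq: "(R ^^ Suc k) `` {w} = (\<Union>u\<in>?A. R `` {u})" by auto
  have "card (\<Union>u\<in>?A. R `` {u}) \<le> (\<Sum>u\<in>?A. card (R `` {u}))"
    using Suc by (intro card_UN_le) auto
  also have "\<dots> \<le> (\<Sum>u\<in>?A. D)" using assms by (intro sum_mono) auto
  also have "\<dots> \<le> D ^ Suc k" using Suc by simp
  finally show ?case unfolding eq using Suc assms by auto
qed

text \<open>A set of \<open>m\<close> steps with at most \<open>s\<close> vertices each has at most
  \<open>m * s\<close> arcs, which caps the path lengths \<open>k\<close>; \<open>d * s\<close> will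
  bound the out-degrees.\<close>

definition reach_bound :: "nat \<Rightarrow> nat \<Rightarrow> nat \<Rightarrow> nat" where
  "reach_bound s d m = (\<Sum>k\<le>m * s. (d * s) ^ k)"

lemma card_set_mset_le_size: "card (set_mset M) \<le> size M"
  by (induction M) (auto simp: card_insert_if)

lemma card_step_verts_le:
  assumes "x \<in> random_choices n 1 \<times> player_choices n (s - 1)" "s \<ge> 1"
  shows "card (step_verts x) \<le> s" "finite (step_verts x)"
proof -
  have fin: "finite (fst x)" using assms by (auto simp: random_choices_def intro: card_ge_0_finite)
  have "card (step_verts x) \<le> card (fst x) + card (set_mset (snd x))"
    unfolding step_verts_def by (rule card_Un_le)
  also have "card (set_mset (snd x)) \<le> size (snd x)"
    by (rule card_set_mset_le_size)
  finally show "card (step_verts x) \<le> s"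
    using assms by (auto simp: random_choices_def player_choices_def)
  show "finite (step_verts x)" using fin by (simp add: step_verts_def)
qed

text \<open>By \<open>rich_append_new\<close>, new vertices arise only if \<open>w\<close> is
  \<open>j\<close>-rich, and they are reached from \<open>w\<close> by short paths. Out-degrees are
  bounded thanks to \<open>none\<close>.\<close>

lemma card_new_rich_le:
  assumes h: "h @ [x] \<in> histories n s" and s: "s \<ge> 1" and d: "d \<le> m" "d \<ge> 1"
    and none: "\<And>v. v \<in> {1..n} \<Longrightarrow> \<not> rich h m d v" and x: "fst x = {w}"
  shows "card {v \<in> {1..n}. rich (h @ [x]) m (Suc j) v} \<le>
    card {v \<in> {1..n}. rich h m (Suc j) v} + (if rich h m j w then reach_bound s d m else 0)"
proof -
  let ?h = "h @ [x]"
  \<comment> \<open>The witness \<open>F\<close> varies with \<open>v\<close>; using the arcs of all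
    steps gives one set \<open>Q\<close> for all \<open>v\<close>.\<close>
  define R where "R = arcs ?h {..<length ?h}"
  define Q where "Q = (if rich h m j w then \<Union>k\<in>{..m * s}. (R ^^ k) `` {w} else {})"
  have el: "?h ! i \<in> random_choices n 1 \<times> player_choices n (s - 1)" if "i < length ?h" for i
    using h nth_mem[OF that] unfolding in_lists_conv_set by blast
  \<comment> \<open>Being random \<open>d\<close> times would make \<open>u\<close> \<open>d\<close>-rich, so the new step is at most its \<open>d\<close>-th.\<close>
  have out: "finite (R `` {u}) \<and> card (R `` {u}) \<le> d * s" for u
  proof -
    let ?I = "{i. i < length ?h \<and> u \<in> fst (?h ! i)}" and ?J = "{i. i < length h \<and> u \<in> fst (h ! i)}"
    have eq: "R `` {u} = (\<Union>i\<in>?I. step_verts (?h ! i))"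
      by (auto simp: R_def arcs_def)
    have J: "card ?J < d"
    \<comment> \<open>The assumption \<open>none\<close> covers only \<open>{1..n}\<close>; a vertex
      outside is never random and falls under the first case.\<close>
    proof (cases "?J = {}")
      case True
      then show ?thesis using d by (simp only: card.empty)
    next
      case False
      then obtain i where i: "i < length h" "u \<in> fst (h ! i)" by auto
      have "u \<in> {1..n}" using el[of i] i by (auto simp: nth_append random_choices_def)
      then have "\<not> rich h m d u" by (rule none)
      moreover have "card (fst y) = 1" if "y \<in> set h" for y
        using h that by (auto simp: random_choices_def)
      ultimately show ?thesis using rich_if_hit[of d h u m] d by force
    qed
    have "card ?I \<le> card (insert (length h) ?J)"
      by (intro card_mono) (auto simp: nth_append less_Suc_eq split: if_splits)
    also have "\<dots> \<le> d" using J by (simp add: card_insert_if)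
    finally have I: "card ?I \<le> d" .
    have "card (R `` {u}) \<le> (\<Sum>i\<in>?I. card (step_verts (?h ! i)))"
      unfolding eq by (intro card_UN_le) auto
    also have "\<dots> \<le> (\<Sum>i\<in>?I. s)"
      using el s by (intro sum_mono card_step_verts_le) auto
    also have "\<dots> \<le> d * s" using I by simp
    finally have "card (R `` {u}) \<le> d * s" .
    moreover have "finite (R `` {u})"
      unfolding eq using card_step_verts_le(2)[OF el s] by auto
    ultimately show ?thesis by simp
  qed
  note pow = card_relpow_Image_le[of R, OF out]
  have finQ: "finite Q" unfolding Q_def using pow by auto
  have cardQ: "card Q \<le> (if rich h m j w then reach_bound s d m else 0)"
  proof (cases "rich h m j w")
    case True
    have "card (\<Union>k\<in>{..m * s}. (R ^^ k) `` {w}) \<le> (\<Sum>k\<le>m * s. card ((R ^^ k) `` {w}))"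
      by (intro card_UN_le) auto
    also have "\<dots> \<le> reach_bound s d m" unfolding reach_bound_def using pow by (intro sum_mono) auto
    finally show ?thesis using True by (simp add: Q_def)
  qed (simp add: Q_def)
  have "v \<in> Q" if new: "rich ?h m (Suc j) v" "\<not> rich h m (Suc j) v" for v
  proof -
    from rich_append_new[OF new x] obtain F where F: "rich h m j w" "F \<subseteq> {..<length ?h}"
      "card F \<le> m" "(w, v) \<in> (arcs ?h F)\<^sup>*" by blast
    have finF: "finite F" using F(2) finite_subset by blast
    let ?P = "\<lambda>i. fst (?h ! i) \<times> step_verts (?h ! i)"
    have P: "finite (?P i) \<and> card (?P i) \<le> s" if "i \<in> F" for i
    proof -
      have i: "i < length ?h" using F(2) that by auto
      have "card (fst (?h ! i)) = 1" using el[OF i] by (auto simp: random_choices_def)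
      then show ?thesis
        using card_step_verts_le[OF el[OF i] s] by (simp add: card_cartesian_product card_ge_0_finite)
    qed
    have eq: "arcs ?h F = (\<Union>i\<in>F. ?P i)" by (auto simp: arcs_def)
    have fin: "finite (arcs ?h F)" unfolding eq using finF P by blast
    have "card (arcs ?h F) \<le> (\<Sum>i\<in>F. card (?P i))" unfolding eq using finF by (rule card_UN_le)
    also have "\<dots> \<le> (\<Sum>i\<in>F. s)" using P by (intro sum_mono) auto
    also have "\<dots> \<le> m * s" using F(3) by simp
    finally have le: "card (arcs ?h F) \<le> m * s" .
    \<comment> \<open>In a finite relation a path needs at most as many arcs as the relation
      has.\<close>
    obtain k where k: "k \<le> card (arcs ?h F)" "(w, v) \<in> arcs ?h F ^^ k"
      using F(4) rtrancl_finite_eq_relpow[OF fin] by auto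
    have "arcs ?h F ^^ k \<subseteq> R ^^ k" unfolding R_def by (intro relpow_subset_mono arcs_mono F)
    then show ?thesis using k le F(1) by (auto simp: Q_def)
  qed
  then have "{v \<in> {1..n}. rich ?h m (Suc j) v} \<subseteq> {v \<in> {1..n}. rich h m (Suc j) v} \<union> Q"
    by auto
  then have "card {v \<in> {1..n}. rich ?h m (Suc j) v} \<le> card ({v \<in> {1..n}. rich h m (Suc j) v} \<union> Q)"
    using finQ by (intro card_mono) auto
  also have "\<dots> \<le> card {v \<in> {1..n}. rich h m (Suc j) v} + card Q" by (rule card_Un_le)
  finally show ?thesis using cardQ by linarith
qed

section \<open>Copies of a hypergraph\<close>

text \<open>This turns a sub-multiset of the edges into a set of steps, with parallel edges coming
  from distinct steps. The preimage \<open>N\<close> has multiplicities at most one, so it is a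
  set.\<close>

lemma subset_mset_image_obtain:
  assumes "M \<subseteq># image_mset f (mset_set I)" "finite I"
  obtains F where "F \<subseteq> I" "image_mset f (mset_set F) = M"
proof -
  obtain N where N: "N \<subseteq># mset_set I" "image_mset f N = M"
    using assms(1) by (metis mset_subset_eq_exists_conv image_mset_eq_plusD mset_subset_eq_add_left)
  have "count N i \<le> 1" for i
    using N(1) by (metis count_mset_set' le_zero_eq mset_subset_eq_count order_trans zero_le_one order_refl)
  then have "mset_set (set_mset N) = N"
    by (intro multiset_eqI) (metis count_mset_set(1) count_mset_set(3) finite_set_mset le_neq_implies_less less_one not_in_iff)
  moreover have "set_mset N \<subseteq> I" using set_mset_mono[OF N(1)] assms(2) by simp
  ultimately show thesis using that[of "set_mset N"] N by simp
qed

text \<open>By minimality of the degeneracy, \<open>G\<close> has a nonempty sub-hypergraph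
  \<open>G'\<close> of minimum degree at least \<open>d\<close>. The steps \<open>F\<close> forming
  the copy of \<open>G'\<close> make each of its vertices rich.\<close>

lemma rich_if_contains_copy:
  assumes copy: "contains_copy (history_hypergraph n h) G"
    and deg: "degeneracy G = d" "d \<ge> 1" and m: "size (edges G) \<le> m"
    and fin: "\<And>x. x \<in> set h \<Longrightarrow> finite (fst x)"
  shows "\<exists>v\<in>{1..n}. rich h m d v"
proof -
  let ?e = "\<lambda>i. case h ! i of (U, V) \<Rightarrow> mset_set U + V"
  have "\<not> degenerate (d - 1) G"
    using deg not_less_Least[of "d - 1" "\<lambda>d. degenerate d G"] by (simp add: degeneracy_def)
  then obtain G' where "subhypergraph G' G \<and> verts G' \<noteq> {}" "\<not> min_degree G' \<le> d - 1"
    unfolding degenerate_def by blast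
  then have G': "subhypergraph G' G" "verts G' \<noteq> {}" "min_degree G' \<ge> d"
    by auto
  have finG': "finite (verts G')" using G'(1) by (auto simp: subhypergraph_def hypergraph_def)
  obtain H' f where H': "subhypergraph H' (history_hypergraph n h)"
    and bij: "bij_betw f (verts G) (verts H')"
    and ed: "edges H' = image_mset (image_mset f) (edges G)"
    using copy by (auto simp: contains_copy_def isomorphic_def)
  have inj: "inj_on f (verts G)" using bij by (rule bij_betw_imp_inj_on)
  have sub: "verts G' \<subseteq> verts G" "edges G' \<subseteq># edges G"
    and hyp': "\<And>e. e \<in># edges G' \<Longrightarrow> set_mset e \<subseteq> verts G'"
    using G'(1) by (auto simp: subhypergraph_def hypergraph_def)
  have "mset (map (\<lambda>(U, V). mset_set U + V) h) = image_mset ?e (mset_set {..<length h})"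
  proof -
    have "map (\<lambda>(U, V). mset_set U + V) h = map ?e [0..<length h]"
      by (rule nth_equalityI) auto
    then show ?thesis by (simp add: atLeast0LessThan)
  qed
  moreover have "image_mset (image_mset f) (edges G') \<subseteq># mset (map (\<lambda>(U, V). mset_set U + V) h)"
    using image_mset_subseteq_mono[OF sub(2), of "image_mset f"] H' ed
    by (auto simp: subhypergraph_def history_hypergraph_def)
  ultimately obtain F where F: "F \<subseteq> {..<length h}"
    "image_mset ?e (mset_set F) = image_mset (image_mset f) (edges G')"
    using subset_mset_image_obtain[of _ ?e "{..<length h}"] by (metis finite_lessThan)
  have finF: "finite F" using F(1) finite_subset by blast
  have sv: "set_mset (?e i) = step_verts (h ! i)" if "i \<in> F" for i
  proof -
    have "finite (fst (h ! i))" using F(1) that by (intro fin nth_mem) auto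
    then show ?thesis by (cases "h ! i") (simp add: step_verts_def)
  qed
  have inH: "f ` verts G' \<subseteq> {1..n}"
    using H' bij sub(1) by (auto simp: subhypergraph_def history_hypergraph_def bij_betw_def)
  have stepF: "step_verts (h ! i) \<subseteq> f ` verts G'" if "i \<in> F" for i
  proof -
    have "?e i \<in># image_mset ?e (mset_set F)" using that finF by simp
    then obtain e where "e \<in># edges G'" "?e i = image_mset f e" unfolding F(2) by auto
    then show ?thesis using sv[OF that] hyp' by fastforce
  qed
  have degF: "d \<le> step_degree h F (f v)" if v: "v \<in> verts G'" for v
  proof -
    have "d \<le> vertex_degree G' v" using G'(3) v finG' by (auto simp: min_degree_def intro: order_trans[OF _ Min_le])
    also have "vertex_degree G' v = size (filter_mset (\<lambda>e. f v \<in># e) (image_mset (image_mset f) (edges G')))"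
    proof -
      \<comment> \<open>Injectivity of \<open>f\<close> prevents another vertex of \<open>e\<close>
        from being mapped to \<open>f v\<close>, so degrees are preserved.\<close>
      have "v \<in># e \<longleftrightarrow> f v \<in># image_mset f e" if "e \<in># edges G'" for e
        using inj_on_image_mem_iff[OF inj_on_subset[OF inj sub(1)] v hyp'[OF that]] by simp
      then have "filter_mset (\<lambda>e. v \<in># e) (edges G') = filter_mset (\<lambda>e. f v \<in># image_mset f e) (edges G')"
        by (intro filter_mset_cong) auto
      then show ?thesis by (simp add: vertex_degree_def filter_mset_image_mset)
    qed
    also have "\<dots> = size (filter_mset (\<lambda>e. f v \<in># e) (image_mset ?e (mset_set F)))" by (simp only: F(2))
    also have "\<dots> = size (filter_mset (\<lambda>i. f v \<in># ?e i) (mset_set F))"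
      by (simp add: filter_mset_image_mset)
    also have "filter_mset (\<lambda>i. f v \<in># ?e i) (mset_set F) = filter_mset (\<lambda>i. f v \<in> step_verts (h ! i)) (mset_set F)"
      using sv finF by (intro filter_mset_cong) auto
    also have "size \<dots> = step_degree h F (f v)"
      using finF by (simp add: step_degree_def filter_mset_mset_set)
    finally show ?thesis .
  qed
  \<comment> \<open>An arc starts at the random vertex of a step in \<open>F\<close>, and all
    vertices of that step lie in the copy.\<close>
  have anc: "a \<in> f ` verts G'" if "(a, v) \<in> (arcs h F)\<^sup>*" "v \<in> f ` verts G'" for a v
    using that by (induction rule: converse_rtrancl_induct)
      (use stepF in \<open>auto simp: arcs_def step_verts_def\<close>)
  have "card F = size (image_mset ?e (mset_set F))" by simp
  also have "\<dots> \<le> m" unfolding F(2) using size_mset_mono[OF sub(2)] m by simp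
  finally have cF: "card F \<le> m" .
  obtain v where v: "v \<in> verts G'" using G'(2) by auto
  have "rich h m d (f v)" unfolding rich_def
    using F(1) cF anc degF v by (intro exI[of _ F]) blast
  then show ?thesis using v inH by auto
qed

section \<open>Expected number of rich vertices\<close>

lemma random_choices_1: "random_choices n 1 = (\<lambda>w. {w}) ` {1..n}"
  by (auto simp: random_choices_def card_1_singleton_iff)

lemma set_history_pmf_subset:
  assumes "valid_strategy n 1 s S" "n \<ge> 1"
  shows "set_pmf (history_pmf n 1 S t) \<subseteq> histories n s"
proof (induction t)
  case 0
  then show ?case by simp
next
  case (Suc t)
  have "set_pmf (pmf_of_set (random_choices n 1)) = random_choices n 1"
    using assms(2) unfolding random_choices_1 by (intro set_pmf_of_set) auto
  then show ?case
    using Suc assms(1) unfolding valid_strategy_def by (fastforce simp: set_bind_pmf)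
qed

text \<open>The increment is bounded in terms of \<open>h\<close> and \<open>w\<close> alone. Since
  \<open>w\<close> is uniform given \<open>h\<close> and is drawn before the player reacts,
  averaging over \<open>w\<close> gives a bound independent of the strategy.\<close>

lemma nn_integral_history_Suc_le:
  fixes f g :: "history \<Rightarrow> ennreal" and c :: ennreal
  assumes valid: "valid_strategy n 1 s S" and n: "n \<ge> 1"
    and le: "\<And>h w V. h @ [({w}, V)] \<in> histories n s \<Longrightarrow>
      f (h @ [({w}, V)]) \<le> g h + (if B h w then c else 0)"
  shows "(\<integral>\<^sup>+h. f h \<partial>history_pmf n 1 S (Suc t)) \<le> (\<integral>\<^sup>+h. g h \<partial>history_pmf n 1 S t) +
    c / of_nat n * (\<integral>\<^sup>+h. of_nat (card {w \<in> {1..n}. B h w}) \<partial>history_pmf n 1 S t)"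
proof -
  let ?p = "history_pmf n 1 S t" and ?U = "pmf_of_set (random_choices n 1)"
  have fin: "finite (random_choices n 1)" "random_choices n 1 \<noteq> {}"
    using n unfolding random_choices_1 by auto
  have inj: "inj_on (\<lambda>w. {w}) {1..n}" by (simp add: inj_on_def)
  have inner: "(\<integral>\<^sup>+U. \<integral>\<^sup>+V. f (h @ [(U, V)]) \<partial>S h U \<partial>?U) \<le>
      g h + c / of_nat n * of_nat (card {w \<in> {1..n}. B h w})" if h: "h \<in> histories n s" for h
  proof -
    have "(\<integral>\<^sup>+U. \<integral>\<^sup>+V. f (h @ [(U, V)]) \<partial>S h U \<partial>?U) \<le>
        (\<integral>\<^sup>+U. g h + (if B h (the_elem U) then c else 0) \<partial>?U)"
    proof (intro nn_integral_mono_AE AE_pmfI)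
      fix U assume "U \<in> set_pmf ?U"
      then have U: "U \<in> random_choices n 1" using fin by simp
      then obtain w where w: "U = {w}" unfolding random_choices_1 by auto
      have "(\<integral>\<^sup>+V. f (h @ [(U, V)]) \<partial>S h U) \<le> (\<integral>\<^sup>+V. g h + (if B h w then c else 0) \<partial>S h U)"
      proof (intro nn_integral_mono_AE AE_pmfI)
        fix V assume "V \<in> set_pmf (S h U)"
        then have "V \<in> player_choices n (s - 1)"
          using valid h U unfolding valid_strategy_def by blast
        then have "h @ [({w}, V)] \<in> histories n s" using h U w by simp
        then show "f (h @ [(U, V)]) \<le> g h + (if B h w then c else 0)" using le w by simp
      qed
      then show "(\<integral>\<^sup>+V. f (h @ [(U, V)]) \<partial>S h U) \<le> g h + (if B h (the_elem U) then c else 0)"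
        using w by simp
    qed
    also have "\<dots> = g h + (\<integral>\<^sup>+U. (if B h (the_elem U) then c else 0) \<partial>?U)"
      by (subst nn_integral_add) auto
    also have "(\<integral>\<^sup>+U. (if B h (the_elem U) then c else 0) \<partial>?U) =
        (\<Sum>U\<in>random_choices n 1. if B h (the_elem U) then c else 0) / of_nat (card (random_choices n 1))"
      using fin by (subst nn_integral_pmf_of_set) auto
    also have "(\<Sum>U\<in>random_choices n 1. if B h (the_elem U) then c else 0) =
        (\<Sum>w\<in>{1..n}. if B h w then c else 0)"
      unfolding random_choices_1 by (subst sum.reindex[OF inj]) simp
    also have "\<dots> = c * of_nat (card {w \<in> {1..n}. B h w})"
      by (subst sum.inter_filter[symmetric]) (auto simp: mult.commute)
    also have "card (random_choices n 1) = n"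
      unfolding random_choices_1 using inj by (simp add: card_image)
    finally show ?thesis by (simp add: divide_ennreal_def ac_simps)
  qed
  have "(\<integral>\<^sup>+h. f h \<partial>history_pmf n 1 S (Suc t)) =
      (\<integral>\<^sup>+h. \<integral>\<^sup>+U. \<integral>\<^sup>+V. f (h @ [(U, V)]) \<partial>S h U \<partial>?U \<partial>?p)"
    by simp
  also have "\<dots> \<le> (\<integral>\<^sup>+h. g h + c / of_nat n * of_nat (card {w \<in> {1..n}. B h w}) \<partial>?p)"
    using set_history_pmf_subset[OF valid n] by (intro nn_integral_mono_AE AE_pmfI inner) auto
  also have "\<dots> = (\<integral>\<^sup>+h. g h \<partial>?p) + c / of_nat n * (\<integral>\<^sup>+h. of_nat (card {w \<in> {1..n}. B h w}) \<partial>?p)"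
    by (simp add: nn_integral_add nn_integral_cmult)
  finally show ?thesis .
qed

definition has_rich :: "nat \<Rightarrow> nat \<Rightarrow> nat \<Rightarrow> history \<Rightarrow> bool" where
  "has_rich n m d h \<longleftrightarrow> (\<exists>v\<in>{1..n}. rich h m d v)"

lemma not_rich_Nil: "\<not> rich [] m (Suc j) v"
  by (auto simp: rich_def step_degree_def)

text \<open>Used for the induction on time with \<open>y = C * t / n\<close> and
  \<open>z = C / n\<close>, so that \<open>y + z\<close> belongs to time
  \<open>t + 1\<close>.\<close>

lemma power_mult_add_le:
  fixes N y z :: real
  assumes "N \<ge> 0" "y \<ge> 0" "z \<ge> 0"
  shows "N * y ^ Suc j + z * (N * y ^ j) \<le> N * (y + z) ^ Suc j"
proof -
  have "N * y ^ Suc j + z * (N * y ^ j) = N * ((y + z) * y ^ j)" by (simp add: algebra_simps)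
  also have "\<dots> \<le> N * ((y + z) * (y + z) ^ j)"
    using assms by (intro mult_left_mono power_mono) auto
  finally show ?thesis by simp
qed

lemma ennreal_add_mult:
  assumes "a \<ge> 0" "b \<ge> 0" "z \<ge> 0"
  shows "ennreal a + ennreal z * ennreal b = ennreal (a + z * b)"
  using assms by (simp add: ennreal_mult)

text \<open>The condition \<open>\<not> has_rich\<close> stops the count at the first \<open>d\<close>-rich vertex; after that
  out-degrees are no longer bounded.\<close>

lemma nn_integral_card_rich_le:
  assumes valid: "valid_strategy n 1 s S" and n: "n \<ge> 1" and s: "s \<ge> 1" and d: "d \<le> m" "d \<ge> 1"
  shows "(\<integral>\<^sup>+h. of_nat (card {v \<in> {1..n}. \<not> has_rich n m d h \<and> rich h m j v}) \<partial>history_pmf n 1 S t)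
    \<le> ennreal (real n * (real (reach_bound s d m) * real t / real n) ^ j)"
proof (induction t arbitrary: j)
  case 0
  show ?case
  proof (cases j)
    \<comment> \<open>The claimed bound is \<open>n\<close> here, because
      \<open>0 ^ 0 = 1\<close>.\<close>
    case 0
    have "card {v \<in> {1..n}. \<not> has_rich n m d [] \<and> rich [] m j v} \<le> card {1..n}"
      by (intro card_mono) auto
    then show ?thesis using 0 by (simp add: ennreal_of_nat_eq_real_of_nat)
  qed (simp add: not_rich_Nil)
next
  case (Suc t)
  let ?C = "reach_bound s d m" and ?p = "history_pmf n 1 S"
  let ?R = "\<lambda>j h. {v \<in> {1..n}. \<not> has_rich n m d h \<and> rich h m j v}"
  show ?case
  proof (cases j)
    case 0
    have "(\<integral>\<^sup>+h. of_nat (card (?R j h)) \<partial>?p (Suc t)) \<le> (\<integral>\<^sup>+h. of_nat n \<partial>?p (Suc t))"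
    proof (intro nn_integral_mono)
      fix h
      have "card (?R j h) \<le> card {1..n}" by (intro card_mono) auto
      then show "(of_nat (card (?R j h)) :: ennreal) \<le> of_nat n" by (intro of_nat_mono) simp
    qed
    also have "\<dots> = ennreal (real n)" by (simp add: ennreal_of_nat_eq_real_of_nat)
    finally show ?thesis using 0 by simp
  next
    case (Suc i)
    let ?N = "\<lambda>i h. of_nat (card (?R i h)) :: ennreal"
    have step: "?N (Suc i) (h @ [({w}, V)]) \<le>
        ?N (Suc i) h + (if \<not> has_rich n m d h \<and> rich h m i w then of_nat ?C else 0)"
      if h: "h @ [({w}, V)] \<in> histories n s" for h w V
    proof (cases "has_rich n m d h")
      case True
      \<comment> \<open>A \<open>d\<close>-rich vertex stays \<open>d\<close>-rich, so the stopped
        count remains zero.\<close>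
      then have "has_rich n m d (h @ [({w}, V)])" unfolding has_rich_def using rich_append[of h] by meson
      then show ?thesis by simp
    next
      case False
      have "card (?R (Suc i) (h @ [({w}, V)])) \<le> card {v \<in> {1..n}. rich (h @ [({w}, V)]) m (Suc i) v}"
        by (intro card_mono) auto
      also have "\<dots> \<le> card {v \<in> {1..n}. rich h m (Suc i) v} + (if rich h m i w then ?C else 0)"
        using False by (intro card_new_rich_le[OF h s d]) (auto simp: has_rich_def)
      finally have "?N (Suc i) (h @ [({w}, V)]) \<le>
          of_nat (card {v \<in> {1..n}. rich h m (Suc i) v} + (if rich h m i w then ?C else 0))"
        by (rule of_nat_mono)
      then show ?thesis using False by (simp split: if_splits)
    qed
    have "(\<integral>\<^sup>+h. ?N (Suc i) h \<partial>?p (Suc t)) \<le> (\<integral>\<^sup>+h. ?N (Suc i) h \<partial>?p t) +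
        of_nat ?C / of_nat n * (\<integral>\<^sup>+h. ?N i h \<partial>?p t)"
      by (rule nn_integral_history_Suc_le[where f = "?N (Suc i)" and g = "?N (Suc i)"
            and c = "of_nat ?C" and B = "\<lambda>h w. \<not> has_rich n m d h \<and> rich h m i w", OF valid n step])
    \<comment> \<open>The induction hypothesis enters at both levels \<open>Suc i\<close> and
      \<open>i\<close>, hence the generalization over \<open>j\<close>.\<close>
    also have "\<dots> \<le> ennreal (real n * (real ?C * real t / real n) ^ Suc i) +
        of_nat ?C / of_nat n * ennreal (real n * (real ?C * real t / real n) ^ i)"
      by (intro add_mono mult_left_mono Suc.IH) auto
    also have "of_nat ?C / of_nat n = ennreal (real ?C / real n)"
      using n by (simp add: ennreal_of_nat_eq_real_of_nat divide_ennreal)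
    also have "ennreal (real n * (real ?C * real t / real n) ^ Suc i) +
        ennreal (real ?C / real n) * ennreal (real n * (real ?C * real t / real n) ^ i) =
        ennreal (real n * (real ?C * real t / real n) ^ Suc i +
          real ?C / real n * (real n * (real ?C * real t / real n) ^ i))"
      by (intro ennreal_add_mult) auto
    also have "\<dots> \<le> ennreal (real n * (real ?C * real t / real n + real ?C / real n) ^ Suc i)"
      by (intro ennreal_leI power_mult_add_le) auto
    also have "real ?C * real t / real n + real ?C / real n = real ?C * real (Suc t) / real n"
      by (simp add: field_simps add_divide_distrib)
    finally show ?thesis using Suc by simp
  qed
qed

text \<open>The stopped count of \<open>d\<close>-rich vertices is always zero and says nothing
  here. Instead, a first \<open>d\<close>-rich vertex can only appear when the random vertex is
  \<open>(d - 1)\<close>-rich, and the stopped count at level \<open>d - 1\<close> bounds the chance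
  of that.\<close>

lemma prob_has_rich_le:
  assumes valid: "valid_strategy n 1 s S" and n: "n \<ge> 1" and s: "s \<ge> 1" and d: "d \<le> m" "d \<ge> 1"
  shows "emeasure (history_pmf n 1 S t) {h. has_rich n m d h}
    \<le> ennreal (real n * (real (reach_bound s d m) * real t / real n) ^ d)"
proof (induction t)
  case 0
  show ?case using d by (cases d) (simp_all add: has_rich_def not_rich_Nil)
next
  case (Suc t)
  let ?C = "reach_bound s d m" and ?p = "history_pmf n 1 S"
  let ?R = "\<lambda>j h. {v \<in> {1..n}. \<not> has_rich n m d h \<and> rich h m j v}"
  let ?I = "indicator {h. has_rich n m d h} :: history \<Rightarrow> ennreal"
  obtain i where i: "d = Suc i" using d by (cases d) auto
  \<comment> \<open>The term for \<open>k = 0\<close> is one. This allows weakening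
    \<open>1 / n\<close> to \<open>C / n\<close> below, to fit
    \<open>power_mult_add_le\<close>.\<close>
  have C: "real ?C \<ge> 1"
  proof -
    have "(d * s) ^ 0 \<le> ?C" unfolding reach_bound_def by (rule member_le_sum) auto
    then show ?thesis by simp
  qed
  have step: "?I (h @ [({w}, V)]) \<le> ?I h + (if \<not> has_rich n m d h \<and> rich h m i w then 1 else 0)"
    if h: "h @ [({w}, V)] \<in> histories n s" for h w V
  proof (cases "has_rich n m d h \<or> \<not> has_rich n m d (h @ [({w}, V)])")
    case True
    then show ?thesis by (auto simp: indicator_def)
  next
    case False
    then obtain v where "rich (h @ [({w}, V)]) m (Suc i) v" "\<not> rich h m (Suc i) v"
      by (auto simp: has_rich_def i)
    then have "rich h m i w" by (rule rich_append_new) auto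
    then show ?thesis using False by (auto simp: indicator_def)
  qed
  have "emeasure (?p (Suc t)) {h. has_rich n m d h} = (\<integral>\<^sup>+h. ?I h \<partial>?p (Suc t))"
    by (subst nn_integral_indicator) auto
  also have "\<dots> \<le> (\<integral>\<^sup>+h. ?I h \<partial>?p t) + 1 / of_nat n * (\<integral>\<^sup>+h. of_nat (card (?R i h)) \<partial>?p t)"
    by (rule nn_integral_history_Suc_le[where f = ?I and g = ?I and c = 1
          and B = "\<lambda>h w. \<not> has_rich n m d h \<and> rich h m i w", OF valid n step])
  also have "(\<integral>\<^sup>+h. ?I h \<partial>?p t) = emeasure (?p t) {h. has_rich n m d h}"
    by (subst nn_integral_indicator) auto
  also have "emeasure (?p t) {h. has_rich n m d h} + 1 / of_nat n * (\<integral>\<^sup>+h. of_nat (card (?R i h)) \<partial>?p t) \<le>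
      ennreal (real n * (real ?C * real t / real n) ^ Suc i) +
      1 / of_nat n * ennreal (real n * (real ?C * real t / real n) ^ i)"
    using Suc.IH i
    by (intro add_mono mult_left_mono nn_integral_card_rich_le[OF valid n s d]) auto
  also have "1 / of_nat n = ennreal (1 / real n)"
    using n by (simp add: ennreal_of_nat_eq_real_of_nat divide_ennreal flip: ennreal_1)
  also have "ennreal (real n * (real ?C * real t / real n) ^ Suc i) +
      ennreal (1 / real n) * ennreal (real n * (real ?C * real t / real n) ^ i) =
      ennreal (real n * (real ?C * real t / real n) ^ Suc i +
        1 / real n * (real n * (real ?C * real t / real n) ^ i))"
    by (intro ennreal_add_mult) auto
  also have "\<dots> \<le> ennreal (real n * (real ?C * real t / real n) ^ Suc i +
        real ?C / real n * (real n * (real ?C * real t / real n) ^ i))"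
    using C by (intro ennreal_leI add_mono mult_right_mono divide_right_mono) auto
  also have "\<dots> \<le> ennreal (real n * (real ?C * real t / real n + real ?C / real n) ^ Suc i)"
    by (intro ennreal_leI power_mult_add_le) auto
  also have "real ?C * real t / real n + real ?C / real n = real ?C * real (Suc t) / real n"
    by (simp add: field_simps add_divide_distrib)
  finally show ?case using i by simp
qed

section \<open>Choice of the constants and passage to the limit\<close>

theorem theorem1p5:
  fixes s d :: nat and G :: "'a hypergraph" and \<omega> :: "nat \<Rightarrow> real"
    and S :: "nat \<Rightarrow> strategy"
  assumes "s \<ge> 2"
    and "hypergraph G" and "uniform s G"
    and "degeneracy G = d" and "d \<ge> 2"
    and "filterlim \<omega> at_top sequentially"
    and "\<And>n. valid_strategy n 1 s (S n)"
  shows "(\<lambda>n. measure_pmf.prob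
            (semirandom_hypergraph n 1 (S n)
              (nat \<lfloor>real n powr ((real d - 1) / real d) / \<omega> n\<rfloor>))
            {H. contains_copy H G}) \<longlonglongrightarrow> 0"
proof -
  \<comment> \<open>The first summand allows for all edges of a copy, the second ensures
    \<open>d \<le> m\<close>.\<close>
  define m where "m = size (edges G) + d"
  define C where "C = real (reach_bound s d m)"
  define T where "T n = nat \<lfloor>real n powr ((real d - 1) / real d) / \<omega> n\<rfloor>" for n
  let ?P = "\<lambda>n. measure_pmf.prob (semirandom_hypergraph n 1 (S n) (T n)) {H. contains_copy H G}"
  have C: "C \<ge> 0" by (simp add: C_def)
  have bound: "?P n \<le> (C / \<omega> n) ^ d" if n: "n \<ge> 1" and w: "\<omega> n > 0" for n
  proof -
    let ?p = "history_pmf n 1 (S n) (T n)"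
    let ?x = "real n powr ((real d - 1) / real d)"
    have "?P n = measure_pmf.prob ?p {h. contains_copy (history_hypergraph n h) G}"
      by (simp add: semirandom_hypergraph_def vimage_def)
    \<comment> \<open>On the support the random sets are singletons, hence finite as
      \<open>rich_if_contains_copy\<close> requires.\<close>
    also have "\<dots> = measure_pmf.prob ?p ({h. contains_copy (history_hypergraph n h) G} \<inter> set_pmf ?p)"
      by (rule measure_Int_set_pmf[symmetric])
    also have "\<dots> \<le> measure_pmf.prob ?p {h. has_rich n m d h}"
    proof (intro measure_pmf.finite_measure_mono subsetI; clarsimp)
      fix h assume h: "contains_copy (history_hypergraph n h) G" "h \<in> set_pmf (history_pmf n (Suc 0) (S n) (T n))"
      have "h \<in> histories n s"
        using h(2) set_history_pmf_subset[OF assms(7) n] by auto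
      then have "fst x \<in> random_choices n 1" if "x \<in> set h" for x
        using that by auto
      then have "finite (fst x)" if "x \<in> set h" for x
        using that unfolding random_choices_1 by fastforce
      then show "has_rich n m d h"
        using rich_if_contains_copy[OF h(1) assms(4)] assms(5) by (auto simp: m_def has_rich_def)
    qed
    also have "\<dots> \<le> real n * (C * real (T n) / real n) ^ d"
      using prob_has_rich_le[OF assms(7) n, of d m "T n"] assms(1,5)
      by (simp add: m_def C_def measure_pmf.emeasure_eq_measure ennreal_le_iff)
    also have "\<dots> \<le> real n * (C * (?x / \<omega> n) / real n) ^ d"
    proof -
      \<comment> \<open>Positivity of \<open>\<omega> n\<close> makes the quotient nonnegative, so
        truncation by \<open>nat\<close> does not increase it.\<close>
      have "real (T n) \<le> ?x / \<omega> n" using w by (simp add: T_def)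
      then show ?thesis
        using C by (intro mult_left_mono power_mono divide_right_mono) auto
    qed
    \<comment> \<open>The exponent \<open>(d - 1) / d\<close> makes the powers of \<open>n\<close>
      cancel: \<open>?x ^ d\<close> equals \<open>n ^ (d - 1)\<close>.\<close>
    also have "\<dots> = (C / \<omega> n) ^ d * (?x ^ d / real n ^ (d - 1))"
    proof -
      have "real n ^ d = real n * real n ^ (d - 1)" using assms(5) by (cases d) auto
      then show ?thesis using n by (simp add: power_divide power_mult_distrib)
    qed
    also have "?x ^ d = real n ^ (d - 1)"
    proof -
      have "?x ^ d = real n powr (real d - 1)"
        using n assms(5) by (simp add: powr_powr flip: powr_realpow)
      also have "\<dots> = real n powr real (d - 1)" using assms(5) by simp
      also have "\<dots> = real n ^ (d - 1)" using n by (intro powr_realpow) auto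
      finally show ?thesis .
    qed
    finally show ?thesis using n by simp
  qed
  have lim: "(\<lambda>n. (C / \<omega> n) ^ d) \<longlonglongrightarrow> 0"
  proof -
    have "(\<lambda>n. C / \<omega> n) \<longlonglongrightarrow> 0"
      using assms(6) by (intro real_tendsto_divide_at_top[OF tendsto_const])
    then have "(\<lambda>n. (C / \<omega> n) ^ d) \<longlonglongrightarrow> 0 ^ d" by (rule tendsto_power)
    then show ?thesis using assms(5) by (simp add: power_0_left)
  qed
  have ev: "eventually (\<lambda>n. ?P n \<le> (C / \<omega> n) ^ d) sequentially"
    using eventually_ge_at_top[of 1] filterlim_at_top_dense[THEN iffD1, OF assms(6), rule_format, of 0]
    by eventually_elim (rule bound)
  have "?P \<longlonglongrightarrow> 0"
    by (rule tendsto_sandwich[OF always_eventually ev tendsto_const lim]) simp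
  then show ?thesis unfolding T_def .
qed

end
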